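(* Let $(S,\Sigma,\mu)$ be a positive measure space, let $1<p<\infty$, let $X$ be a (real or complex) Banach space whose norm is Fréchet differentiable, and let $G$ be a (linear, not necessarily closed) subspace of $L^{p}(\mu,X)$. Let $f\in L^{p}(\mu,X)\setminus\overline{G}$ and $g_0\in G$. Then $g_0\in\mathcal{P}_G(f)$ if and only if $$\int_{Z(f-g_0)^c}\|f(s)-g_0(s)\|^{p-1}F_{f(s)-g_0(s)}(g(s))\,d\mu(s)=0\quad\text{for all } g\in G.$$
   Context: For a positive measure space $(S,\Sigma,\mu)$ and a Banach space $X$, $L^{p}(\mu,X)$ is the Lebesgue-Bochner space of (classes modulo a.e. equality of) strongly measurable functions $f:S\to X$ with $\int_S\|f(s)\|^p\,d\mu(s)<\infty$, normed by $\|f\|=\big(\int_S\|f(s)\|^p\,d\mu(s)\big)^{1/p}$. The norm of $X$ is Fréchet differentiable if for every $0\neq x\in X$ there is a bounded real-linear functional $\varphi:X\to\mathbb{R}$ with $\lim_{h\to0}\frac{|\|x+h\|-\|x\|-\varphi(h)|}{\|h\|}=0$. For $0\neq x\in X$, a support map $F_x$ at $x$ is a bounded linear functional on $X$ (linear over the scalar field of $X$) with $\|F_x\|=1$ and $F_x(x)=\|x\|$; when the norm is Fréchet differentiable, $F_x$ is unique for each $x\neq0$. For a function $h:S\to X$, $Z(h)=\{s\in S: h(s)=0\}$ and $Z(h)^c$ is its complement in $S$. For a subspace $G$ of a normed space $E$ and $f\in E$, $\mathcal{P}_G(f)$ is the set of best approximants of $f$ in $G$, i.e. the set of $g_0\in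 G$ with $\|f-g_0\|=\inf\{\|f-g\|:g\in G\}$. *)

theory Defs
  imports "HOL-Analysis.Analysis" "HOL-Library.Function_Algebras"
begin

text \<open>
  The distribution has no type class of complex Banach spaces. We therefore equip a type of class
  \<open>banach\<close> with an explicit scalar multiplication \<open>sc\<close> over a scalar field \<open>'k\<close> that
  restricts to the built-in real scalar multiplication and is compatible with the norm. By the
  Frobenius theorem the types of class \<open>real_normed_field\<close> and \<open>euclidean_space\<close> are, up to
  isometric isomorphism, exactly \<open>real\<close> and \<open>complex\<close>. For \<open>'k = real\<close> necessarily
  \<open>sc = scaleR\<close>.
\<close>

locale normed_space_over = vector_space sc
  for sc :: "'k::{real_normed_field, euclidean_space} \<Rightarrow> 'x::real_normed_vector \<Rightarrow> 'x" +
  assumes sc_of_real: "sc (of_real r) x = r *\<^sub>R x"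
    and norm_sc: "norm (sc c x) = norm c * norm x"

lemma normed_space_over_real:
  "normed_space_over (scaleR :: real \<Rightarrow> 'x::real_normed_vector \<Rightarrow> 'x)"
  by unfold_locales (auto simp: algebra_simps)

lemma normed_space_over_complex:
  "normed_space_over ((*) :: complex \<Rightarrow> complex \<Rightarrow> complex)"
  by unfold_locales (auto simp: algebra_simps norm_mult scaleR_conv_of_real)

text \<open>
  For non-separable \<open>'x\<close>, Borel measurability is weaker than strong measurability. The limit is
  required everywhere rather than almost everywhere, so that strongly measurable functions are
  Borel measurable also when \<open>M\<close> is not complete; every class modulo a.e. equality of a.e.
  limits of simple functions contains such a function.
\<close>

definition strongly_measurable :: "'s measure \<Rightarrow> ('s \<Rightarrow> 'x::topological_space) \<Rightarrow> bool" where
  "strongly_measurable M f \<longleftrightarrow>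
     (\<exists>u :: nat \<Rightarrow> 's \<Rightarrow> 'x. (\<forall>n. simple_function M (u n)) \<and>
        (\<forall>s\<in>space M. (\<lambda>n. u n s) \<longlonglongrightarrow> f s))"

text \<open>
  As usual in the library, elements of \<open>L\<^sup>p(M, X)\<close> are represented by functions rather than by
  classes modulo a.e. equality, so \<open>Lp_norm\<close> is a seminorm on \<open>Lp_space\<close>.
\<close>

definition Lp_space :: "'s measure \<Rightarrow> real \<Rightarrow> ('s \<Rightarrow> 'x::real_normed_vector) set" where
  "Lp_space M p = {f. strongly_measurable M f \<and> integrable M (\<lambda>s. norm (f s) powr p)}"

definition Lp_norm :: "'s measure \<Rightarrow> real \<Rightarrow> ('s \<Rightarrow> 'x::real_normed_vector) \<Rightarrow> real" where
  "Lp_norm M p f = (LINT s|M. norm (f s) powr p) powr (1 / p)"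

definition Lp_closure ::
    "'s measure \<Rightarrow> real \<Rightarrow> ('s \<Rightarrow> 'x::real_normed_vector) set \<Rightarrow> ('s \<Rightarrow> 'x) set" where
  "Lp_closure M p G = {f \<in> Lp_space M p. \<forall>e>0. \<exists>g\<in>G. Lp_norm M p (f - g) < e}"

definition Lp_subspace ::
    "('k::comm_ring_1 \<Rightarrow> 'x::real_normed_vector \<Rightarrow> 'x) \<Rightarrow> 's measure \<Rightarrow> real \<Rightarrow> ('s \<Rightarrow> 'x) set \<Rightarrow> bool" where
  "Lp_subspace sc M p G \<longleftrightarrow> G \<subseteq> Lp_space M p \<and> module.subspace (\<lambda>c g s. sc c (g s)) G"

definition best_approximants :: "('e::minus \<Rightarrow> real) \<Rightarrow> 'e set \<Rightarrow> 'e \<Rightarrow> 'e set" where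
  "best_approximants N G f = {g0 \<in> G. N (f - g0) = (INF g\<in>G. N (f - g))}"

definition is_support_map ::
    "('k::real_normed_field \<Rightarrow> 'x::real_normed_vector \<Rightarrow> 'x) \<Rightarrow> 'x \<Rightarrow> ('x \<Rightarrow> 'k) \<Rightarrow> bool" where
  "is_support_map sc x \<phi> \<longleftrightarrow>
     bounded_linear \<phi> \<and> (\<forall>c y. \<phi> (sc c y) = c * \<phi> y) \<and> onorm \<phi> = 1 \<and> \<phi> x = of_real (norm x)"

text \<open>Meaningful only where support maps are unique, e.g. at \<open>x \<noteq> 0\<close> for a Frechet
  differentiable norm.\<close>

definition support_map ::
    "('k::real_normed_field \<Rightarrow> 'x::real_normed_vector \<Rightarrow> 'x) \<Rightarrow> 'x \<Rightarrow> 'x \<Rightarrow> 'k" where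
  "support_map sc x = (THE \<phi>. is_support_map sc x \<phi>)"

definition zero_set :: "'s measure \<Rightarrow> ('s \<Rightarrow> 'x::zero) \<Rightarrow> 's set" where
  "zero_set M h = {s \<in> space M. h s = 0}"

end

theory Submission imports Defs
begin

text \<open>
  Write \<open>h = f - g0\<close>. The real part of \<open>F\<^bsub>x\<^esub>\<close> is the derivative of the norm at \<open>x\<close>, so the convex
  function \<open>h \<mapsto> \<integral> \<parallel>h\<parallel>\<^sup>p\<close> has directional derivative \<open>p * Re (\<integral> \<parallel>h\<parallel>\<^bsup>p-1\<^esup> * F\<^bsub>h\<^esub>(g))\<close> in direction
  \<open>g\<close> (dominated convergence) and lies above its tangents (pointwise convexity). Hence \<open>g0\<close> is a best
  approximant iff all these derivatives vanish on \<open>G\<close>; replacing \<open>g\<close> by \<open>c g\<close> with a scalar \<open>c\<close>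
  turns the vanishing of the real part into that of the integral. Measurability of the integrand
  follows since it is a pointwise limit of difference quotients.
\<close>

section \<open>Inequalities for real powers\<close>

text \<open>Convexity of \<open>x powr p\<close>. The library's tangent inequality needs an interior
  base point, so the boundary cases are done by hand: for \<open>b = 0\<close> the claim becomes
  \<open>(1 - p) * a powr p \<le> 0\<close>.\<close>

lemma powr_above_tangent:
  fixes a b p :: real
  assumes "1 < p" "0 \<le> a" "0 \<le> b"
  shows "a powr p + p * a powr (p - 1) * (b - a) \<le> b powr p"
proof (cases "a = 0 \<or> b = 0")
  case True
  moreover have "a powr p + p * a powr (p - 1) * (- a) = (1 - p) * a powr p" if "0 < a"
    using that by (simp add: powr_diff field_simps)
  ultimately show ?thesis
    using assms by (cases "a = 0") (auto simp: mult_nonpos_nonneg)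
next
  case False
  have "p * a powr (p - 1) * (b - a) \<le> b powr p - a powr p"
  proof (rule convex_on_imp_above_tangent[where A = "{0<..}"])
    show "convex_on {0<..} (\<lambda>x::real. x powr p)"
      using powr_convex[of p] assms by (auto intro: convex_on_subset)
  qed (use assms False in \<open>auto intro!: derivative_eq_intros simp: interior_open powr_diff\<close>)
  then show ?thesis by simp
qed

text \<open>A mean value estimate that follows from the tangent inequality at \<open>a\<close> and
  at \<open>b\<close>, which bound the two signs of the difference.\<close>

lemma powr_diff_le:
  fixes a b c p :: real
  assumes "1 < p" "0 \<le> a" "0 \<le> b" "a \<le> c" "b \<le> c"
  shows "\<bar>b powr p - a powr p\<bar> \<le> p * c powr (p - 1) * \<bar>b - a\<bar>"
proof -
  have *: "p * x powr (p - 1) * (x - y) \<le> p * c powr (p - 1) * \<bar>b - a\<bar>"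
    if "x = a \<and> y = b \<or> x = b \<and> y = a" for x y
  proof -
    have "p * x powr (p - 1) * (x - y) \<le> p * x powr (p - 1) * \<bar>b - a\<bar>"
      using that assms(1) by (intro mult_left_mono) auto
    also have "\<dots> \<le> p * c powr (p - 1) * \<bar>b - a\<bar>"
      using that assms by (intro mult_right_mono mult_left_mono powr_mono2) auto
    finally show ?thesis .
  qed
  show ?thesis
    using powr_above_tangent[of p a b] powr_above_tangent[of p b a] *[of a b] *[of b a] assms
    by (auto simp: abs_le_iff algebra_simps)
qed

text \<open>A crude form of Young's inequality, obtained by replacing both factors by the maximum.
  It makes the integrand of the theorem integrable.\<close>

lemma powr_mult_le_add_powr:
  fixes a b p :: real
  assumes "1 < p" "0 \<le> a" "0 \<le> b"
  shows "a powr (p - 1) * b \<le> a powr p + b powr p"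
proof -
  define m where "m = max a b"
  have "a powr (p - 1) * b \<le> m powr (p - 1) * m"
    using assms by (intro mult_mono powr_mono2) (auto simp: m_def)
  also have "\<dots> = m powr p"
    using assms by (cases "m = 0") (auto simp: powr_diff m_def)
  also have "\<dots> \<le> a powr p + b powr p"
    by (auto simp: m_def max_def)
  finally show ?thesis .
qed

lemma powr_add_le:
  fixes a b p :: real
  assumes "0 \<le> p" "0 \<le> a" "0 \<le> b"
  shows "(a + b) powr p \<le> 2 powr p * (a powr p + b powr p)"
proof -
  have "(a + b) powr p \<le> (2 * max a b) powr p"
    using assms by (intro powr_mono2) auto
  also have "\<dots> = 2 powr p * max a b powr p"
    using assms by (simp add: powr_mult)
  also have "\<dots> \<le> 2 powr p * (a powr p + b powr p)"
    by (intro mult_left_mono) (auto simp: max_def)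
  finally show ?thesis .
qed

section \<open>Directional derivatives of the norm\<close>

text \<open>The step sizes run through a sequence because limits of measurable functions and
  dominated convergence are applied to sequences.\<close>

lemma has_derivative_imp_quotient_LIMSEQ:
  fixes f :: "'a::real_normed_vector \<Rightarrow> real"
  assumes "(f has_derivative D) (at x)"
  shows "(\<lambda>n. (f (x + inverse (Suc n) *\<^sub>R y) - f x) / inverse (Suc n)) \<longlonglongrightarrow> D y"
proof -
  interpret D: bounded_linear D
    using assms by (rule has_derivative_bounded_linear)
  have "((\<lambda>r::real. x + r *\<^sub>R y) has_derivative (\<lambda>r. r *\<^sub>R y)) (at 0)"
    by (auto intro!: derivative_eq_intros)
  with assms have "((\<lambda>r::real. f (x + r *\<^sub>R y)) has_derivative (\<lambda>r. D (r *\<^sub>R y))) (at 0)"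
    using has_derivative_compose[of "\<lambda>r. x + r *\<^sub>R y" "\<lambda>r. r *\<^sub>R y" 0 UNIV f D] by simp
  then have "((\<lambda>r. f (x + r *\<^sub>R y)) has_real_derivative D y) (at 0)"
    by (rule has_derivative_imp_has_field_derivative) (simp add: D.scaleR)
  then have "(\<lambda>r. (f (x + r *\<^sub>R y) - f x) / r) \<midarrow>0\<rightarrow> D y"
    by (simp add: has_field_derivative_iff)
  moreover have "filterlim (\<lambda>n. inverse (real (Suc n))) (at 0) sequentially"
    unfolding filterlim_at using LIMSEQ_inverse_real_of_nat by auto
  ultimately show ?thesis
    by (rule filterlim_compose)
qed

lemma norm_has_derivative_le_norm:
  assumes "(norm has_derivative D) (at x)"
  shows "D y \<le> norm y"
proof (rule LIMSEQ_le_const2[OF has_derivative_imp_quotient_LIMSEQ[OF assms]])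
  have "(norm (x + inverse (Suc n) *\<^sub>R y) - norm x) / inverse (Suc n) \<le> norm y" for n
    using norm_triangle_ineq[of x "inverse (Suc n) *\<^sub>R y"] by (simp add: field_simps)
  then show "\<exists>N. \<forall>n\<ge>N. (norm (x + inverse (Suc n) *\<^sub>R y) - norm x) / inverse (Suc n) \<le> norm y"
    by blast
qed

text \<open>The norm is positively homogeneous, so its difference quotients in the direction
  \<open>x\<close> are constant.\<close>

lemma norm_has_derivative_self:
  assumes "(norm has_derivative D) (at x)"
  shows "D x = norm x"
proof (rule LIMSEQ_unique[OF has_derivative_imp_quotient_LIMSEQ[OF assms, of x]])
  have "norm (x + inverse (Suc n) *\<^sub>R x) = (1 + inverse (Suc n)) * norm x" for n
    using norm_scaleR[of "1 + inverse (Suc n)" x] by (simp add: scaleR_add_left)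
  then have "(norm (x + inverse (Suc n) *\<^sub>R x) - norm x) / inverse (Suc n) = norm x" for n
    by (simp add: distrib_right)
  then show "(\<lambda>n. (norm (x + inverse (Suc n) *\<^sub>R x) - norm x) / inverse (Suc n)) \<longlonglongrightarrow> norm x"
    by simp
qed

section \<open>Recovering a scalar from its real parts\<close>

text \<open>The form \<open>\<lambda>c z. (c * z) \<bullet> 1\<close> plays the role of the real part of \<open>c * z\<close>; it is
  nondegenerate because \<open>z \<noteq> 0\<close> has an inverse.\<close>

lemma ex_inner_mult_one:
  fixes L :: "'k::{real_normed_field, euclidean_space} \<Rightarrow> real"
  assumes "linear L"
  obtains z where "\<And>c. L c = (c * z) \<bullet> 1"
proof -
  \<comment> \<open>\<open>T z\<close> is the Riesz representer of the functional sending
    \<open>c\<close> to \<open>(c * z) \<bullet> 1\<close>. Since \<open>T\<close> is linear and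
    injective on a finite-dimensional space, every functional arises in this way.\<close>
  define T :: "'k \<Rightarrow> 'k" where "T z = adjoint (\<lambda>c. c * z) 1" for z
  have T: "c \<bullet> T z = (c * z) \<bullet> 1" for c z
    unfolding T_def by (rule adjoint_works) (rule bounded_linear.linear[OF bounded_linear_mult_left])
  have "linear T"
  proof
    show "T (x + y) = T x + T y" for x y
      by (subst vector_eq_ldot[symmetric]) (simp add: T inner_add_right ring_distribs inner_add_left)
    show "T (r *\<^sub>R x) = r *\<^sub>R T x" for r x
      by (subst vector_eq_ldot[symmetric]) (simp add: T)
  qed
  moreover have "z = 0" if "T z = 0" for z
    \<comment> \<open>For \<open>z \<noteq> 0\<close> the test scalar \<open>inverse z\<close> would
      give \<open>0 = 1 \<bullet> 1\<close>.\<close>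
    using T[of "inverse z" z] that by (cases "z = 0") auto
  ultimately have "surj T"
    by (intro linear_injective_imp_surjective) (auto simp: linear_injective_0)
  then obtain z where "T z = adjoint L 1"
    by (metis surjD)
  then have "L c = (c * z) \<bullet> 1" for c
    using adjoint_works[OF assms, of c 1] T[of c z] by simp
  then show thesis by (rule that)
qed

lemma eq_if_inner_mult_one_eq:
  fixes z w :: "'k::{real_normed_field, euclidean_space}"
  assumes "\<And>c. (c * z) \<bullet> 1 = (c * w) \<bullet> 1"
  shows "z = w"
proof (rule ccontr)
  assume "z \<noteq> w"
  moreover have "(inverse (z - w) * (z - w)) \<bullet> 1 = 0"
    using assms by (simp add: right_diff_distrib inner_diff_left)
  ultimately show False
    by simp
qed

lemma inner_one_le_norm: "z \<bullet> 1 \<le> norm (z::'k::{real_normed_field, euclidean_space})"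
  using norm_cauchy_schwarz[of z 1] by simp

lemma norm_le_if_inner_mult_one_le:
  fixes z :: "'k::{real_normed_field, euclidean_space}"
  assumes "\<And>c. (c * z) \<bullet> 1 \<le> norm c * r"
  shows "norm z \<le> r"
proof (cases "z = 0")
  case True
  then show ?thesis using assms[of 1] by simp
next
  case False
  \<comment> \<open>The test scalar has norm 1 and rotates \<open>z\<close> onto the positive real
    axis.\<close>
  have "norm z = ((norm z *\<^sub>R inverse z) * z) \<bullet> 1"
    using False by (simp add: dot_square_norm)
  also have "\<dots> \<le> r"
    using assms[of "norm z *\<^sub>R inverse z"] False by (simp add: norm_inverse)
  finally show ?thesis .
qed

section \<open>Support maps and the derivative of the norm\<close>

context normed_space_over
begin

lemma bounded_linear_sc_left: "bounded_linear (\<lambda>c. sc c y)"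
proof
  show "sc (r *\<^sub>R c) y = r *\<^sub>R sc c y" for r c
    by (simp add: scaleR_conv_of_real sc_of_real flip: scale_scale)
  show "\<exists>K. \<forall>c. norm (sc c y) \<le> norm c * K"
    by (auto simp: norm_sc)
qed (rule scale_left_distrib)

lemma sc_scaleR: "sc c (r *\<^sub>R y) = r *\<^sub>R sc c y"
  by (simp add: mult.commute flip: sc_of_real)

lemma bounded_linear_sc_right: "bounded_linear (sc c)"
proof
  show "\<exists>K. \<forall>x. norm (sc c x) \<le> norm x * K"
    by (auto simp: norm_sc mult.commute)
qed (simp_all add: scale_right_distrib sc_scaleR)

lemma is_support_map_le_norm:
  assumes "is_support_map sc x \<phi>"
  shows "norm (\<phi> y) \<le> norm y"
  using assms onorm[of \<phi> y] by (simp add: is_support_map_def)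

text \<open>The real part of a support map at \<open>x\<close> lies below the norm and touches it at \<open>x\<close>, so the two
  have the same derivative.\<close>

lemma is_support_map_imp_norm_derivative:
  assumes \<phi>: "is_support_map sc x \<phi>" and D: "(norm has_derivative D) (at x)"
  shows "(\<phi> y) \<bullet> 1 = D y"
proof -
  have bl: "bounded_linear (\<lambda>y. \<phi> y \<bullet> 1)"
    using \<phi> by (auto simp: is_support_map_def intro: bounded_linear_inner_left_comp)
  have "((\<lambda>y. norm y - \<phi> y \<bullet> 1) has_derivative (\<lambda>y. D y - \<phi> y \<bullet> 1)) (at x)"
    by (intro has_derivative_diff D bounded_linear_imp_has_derivative bl)
  moreover have "\<phi> x \<bullet> 1 = norm x"
    using \<phi> by (simp add: is_support_map_def of_real_def dot_square_norm)
  then have "norm x - \<phi> x \<bullet> 1 \<le> norm y - \<phi> y \<bullet> 1" for y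
    using inner_one_le_norm[of "\<phi> y"] is_support_map_le_norm[OF \<phi>, of y] by simp
  ultimately have "(\<lambda>y. D y - \<phi> y \<bullet> 1) = (\<lambda>_. 0)"
    by (intro has_derivative_local_min) auto
  then show ?thesis
    by (metis eq_iff_diff_eq_0)
qed

text \<open>The derivative \<open>D\<close> of the norm is the real part of the support map. Over
  the complex numbers the construction is the classical
  \<open>\<phi> y = D y - \<i> * D (\<i> y)\<close>; defining \<open>\<phi> y\<close> through all
  values \<open>D (sc c y)\<close> treats both scalar fields at once.\<close>

lemma ex1_support_map:
  assumes "x \<noteq> 0" and "(norm :: 'x \<Rightarrow> real) differentiable (at x)"
  shows "\<exists>!\<phi>. is_support_map sc x \<phi>"
proof -
  obtain D where D: "(norm has_derivative D) (at x)"
    using assms(2) by (auto simp: differentiable_def)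
  interpret D: bounded_linear D
    using D by (rule has_derivative_bounded_linear)
  have "\<exists>z. \<forall>c. D (sc c y) = (c * z) \<bullet> 1" for y
    using ex_inner_mult_one[OF bounded_linear.linear[OF
        bounded_linear_compose[OF D.bounded_linear_axioms bounded_linear_sc_left[of y]]]]
    by metis
  then obtain \<phi> where \<phi>: "\<And>c y. (c * \<phi> y) \<bullet> 1 = D (sc c y)"
    by metis
  have le: "norm (\<phi> y) \<le> norm y" for y
    by (rule norm_le_if_inner_mult_one_le) (metis \<phi> norm_has_derivative_le_norm[OF D] norm_sc)
  have add: "\<phi> (y + z) = \<phi> y + \<phi> z" for y z
    by (rule eq_if_inner_mult_one_eq)
      (simp add: \<phi> distrib_left inner_add_left scale_right_distrib D.add)
  have sc: "\<phi> (sc c y) = c * \<phi> y" for c y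
    by (rule eq_if_inner_mult_one_eq) (simp add: \<phi> flip: mult.assoc)
  have bl: "bounded_linear \<phi>"
  proof
    show "\<phi> (r *\<^sub>R y) = r *\<^sub>R \<phi> y" for r y
      using sc[of "of_real r" y] by (simp add: sc_of_real scaleR_conv_of_real)
    show "\<exists>K. \<forall>x. norm (\<phi> x) \<le> norm x * K"
      using le by (metis mult.right_neutral)
  qed (rule add)
  have 1: "\<phi> x \<bullet> 1 = norm x"
    using \<phi>[of 1 x] norm_has_derivative_self[OF D] by simp
  then have nx: "norm (\<phi> x) = norm x"
    using le[of x] inner_one_le_norm[of "\<phi> x"] by simp
  \<comment> \<open>Both the real part and the modulus of \<open>\<phi> x\<close> equal
    \<open>norm x\<close>, so expanding the square leaves nothing.\<close>
  have "norm (\<phi> x - of_real (norm x)) ^ 2 = 0"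
    unfolding power2_norm_eq_inner of_real_def inner_diff_left inner_diff_right
    using 1 nx by (simp add: inner_commute[of 1] dot_square_norm power2_eq_square)
  then have "\<phi> x = of_real (norm x)"
    by simp
  moreover have "onorm \<phi> = 1"
  proof (rule antisym)
    show "onorm \<phi> \<le> 1"
      using le by (intro onorm_bound) auto
    show "1 \<le> onorm \<phi>"
      using onorm[OF bl, of x] nx assms(1) by simp
  qed
  ultimately have "is_support_map sc x \<phi>"
    using bl sc by (simp add: is_support_map_def)
  moreover have "\<psi> = \<phi>" if \<psi>: "is_support_map sc x \<psi>" for \<psi>
  proof
    fix y
    show "\<psi> y = \<phi> y"
    proof (rule eq_if_inner_mult_one_eq)
      fix c
      \<comment> \<open>Moving \<open>c\<close> into the argument reduces uniqueness to real parts,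
        and the real part of any support map is \<open>D\<close>.\<close>
      have "c * \<psi> y = \<psi> (sc c y)"
        using \<psi> by (simp add: is_support_map_def)
      then show "(c * \<psi> y) \<bullet> 1 = (c * \<phi> y) \<bullet> 1"
        using is_support_map_imp_norm_derivative[OF \<psi> D] \<phi> by simp
    qed
  qed
  ultimately show ?thesis
    by blast
qed

lemma is_support_map_support_map:
  assumes "x \<noteq> 0" and "(norm :: 'x \<Rightarrow> real) differentiable (at x)"
  shows "is_support_map sc x (support_map sc x)"
  unfolding support_map_def using ex1_support_map[OF assms] by (rule theI')

lemma norm_has_derivative_support_map:
  assumes "x \<noteq> 0" and "(norm :: 'x \<Rightarrow> real) differentiable (at x)"
  shows "(norm has_derivative (\<lambda>y. support_map sc x y \<bullet> 1)) (at x)"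
proof -
  obtain D where D: "(norm has_derivative D) (at x)"
    using assms(2) by (auto simp: differentiable_def)
  then have "D = (\<lambda>y. support_map sc x y \<bullet> 1)"
    using is_support_map_imp_norm_derivative[OF is_support_map_support_map[OF assms] D] by auto
  with D show ?thesis by simp
qed

end

section \<open>Strong measurability, Lp spaces and best approximants\<close>

text \<open>Combining the two approximating sequences keeps the functions simple, and continuity of
  \<open>H\<close> in the pair carries over the limit. No product sigma-algebra on the value space
  enters, so separability is not an issue.\<close>

lemma strongly_measurable_compose2:
  assumes "strongly_measurable M f" "strongly_measurable M g"
    and "continuous_on UNIV (\<lambda>x. H (fst x) (snd x))"
  shows "strongly_measurable M (\<lambda>s. H (f s) (g s))"
proof -
  obtain u where u: "\<And>n. simple_function M (u n)" "\<And>s. s \<in> space M \<Longrightarrow> (\<lambda>n. u n s) \<longlonglongrightarrow> f s"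
    using assms(1) by (auto simp: strongly_measurable_def)
  obtain v where v: "\<And>n. simple_function M (v n)" "\<And>s. s \<in> space M \<Longrightarrow> (\<lambda>n. v n s) \<longlonglongrightarrow> g s"
    using assms(2) by (auto simp: strongly_measurable_def)
  have "(\<lambda>n. H (u n s) (v n s)) \<longlonglongrightarrow> H (f s) (g s)" if "s \<in> space M" for s
    using continuous_on_tendsto_compose[OF assms(3) tendsto_Pair[OF u(2) v(2)], of s] that by simp
  then show ?thesis
    unfolding strongly_measurable_def
    by (intro exI[of _ "\<lambda>n s. H (u n s) (v n s)"]) (auto intro: simple_function_compose2 u v)
qed

lemma borel_measurable_norm_strongly_measurable:
  assumes "strongly_measurable M f"
  shows "(\<lambda>s. norm (f s)) \<in> borel_measurable M"
proof -
  obtain u where u: "\<And>n. simple_function M (u n)" "\<And>s. s \<in> space M \<Longrightarrow> (\<lambda>n. u n s) \<longlonglongrightarrow> f s"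
    using assms by (auto simp: strongly_measurable_def)
  show ?thesis
  proof (rule borel_measurable_LIMSEQ_real)
    show "(\<lambda>n. norm (u n s)) \<longlonglongrightarrow> norm (f s)" if "s \<in> space M" for s
      using u(2)[OF that] by (rule tendsto_norm)
    show "(\<lambda>s. norm (u n s)) \<in> borel_measurable M" for n
      by (rule borel_measurable_simple_function[OF simple_function_compose1[OF u(1)]])
  qed
qed

lemma Lp_space_add:
  fixes f g :: "'s \<Rightarrow> 'x::real_normed_vector"
  assumes "0 \<le> p" "f \<in> Lp_space M p" "g \<in> Lp_space M p"
  shows "f + g \<in> Lp_space M p"
proof -
  have sm: "strongly_measurable M (\<lambda>s. f s + g s)"
    using assms by (intro strongly_measurable_compose2[of M f g "(+)"] continuous_intros)
      (auto simp: Lp_space_def)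
  have "integrable M (\<lambda>s. norm (f s + g s) powr p)"
  proof (rule Bochner_Integration.integrable_bound)
    show "integrable M (\<lambda>s. 2 powr p * (norm (f s) powr p + norm (g s) powr p))"
      using assms by (simp add: Lp_space_def)
    show "(\<lambda>s. norm (f s + g s) powr p) \<in> borel_measurable M"
      using borel_measurable_norm_strongly_measurable[OF sm] by simp
    have "norm (f s + g s) powr p \<le> 2 powr p * (norm (f s) powr p + norm (g s) powr p)" for s
      using powr_mono2[OF assms(1) norm_ge_zero norm_triangle_ineq[of "f s" "g s"]]
        powr_add_le[OF assms(1) norm_ge_zero norm_ge_zero, of "f s" "g s"] by linarith
    then show "AE s in M. norm (norm (f s + g s) powr p)
        \<le> norm (2 powr p * (norm (f s) powr p + norm (g s) powr p))"
      by (auto simp: abs_mult)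
  qed
  then show ?thesis
    using sm by (simp add: Lp_space_def plus_fun_def)
qed

lemma Lp_space_uminus:
  assumes "f \<in> Lp_space M p"
  shows "- f \<in> Lp_space M p"
proof -
  have "strongly_measurable M (\<lambda>s. - f s)"
    using assms by (intro strongly_measurable_compose2[of M f f "\<lambda>x y. - x"] continuous_intros)
      (auto simp: Lp_space_def)
  then show ?thesis
    using assms by (simp add: Lp_space_def fun_Compl_def)
qed

lemma Lp_norm_le_iff:
  assumes "0 < p"
  shows "Lp_norm M p f \<le> Lp_norm M p g \<longleftrightarrow>
    (LINT s|M. norm (f s) powr p) \<le> (LINT s|M. norm (g s) powr p)"
  using assms powr_mono2[of "1 / p" "LINT s|M. norm (f s) powr p" "LINT s|M. norm (g s) powr p"]
    powr_less_mono2[of "1 / p" "LINT s|M. norm (g s) powr p" "LINT s|M. norm (f s) powr p"]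
  by (fastforce simp: Lp_norm_def not_le[symmetric])

text \<open>Nonnegativity of \<open>N\<close> bounds the values from below, which makes the
  real-valued \<open>INF\<close> a genuine infimum.\<close>

lemma best_approximants_iff:
  fixes N :: "'e::ab_group_add \<Rightarrow> real"
  assumes "\<And>x. 0 \<le> N x" "g0 \<in> G"
  shows "g0 \<in> best_approximants N G f \<longleftrightarrow> (\<forall>g\<in>G. N (f - g0) \<le> N (f - g))"
proof -
  have bdd: "bdd_below ((\<lambda>g. N (f - g)) ` G)"
    using assms(1) by (auto simp: bdd_below_def)
  show ?thesis
  proof
    assume "g0 \<in> best_approximants N G f"
    then show "\<forall>g\<in>G. N (f - g0) \<le> N (f - g)"
      using cINF_lower[OF bdd] by (auto simp: best_approximants_def)
  next
    assume "\<forall>g\<in>G. N (f - g0) \<le> N (f - g)"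
    then have "N (f - g0) = (INF g\<in>G. N (f - g))"
      using assms(2) bdd by (intro antisym cINF_greatest cINF_lower) auto
    then show "g0 \<in> best_approximants N G f"
      using assms(2) by (simp add: best_approximants_def)
  qed
qed

section \<open>The duality map with gauge \<open>t powr (p - 1)\<close> as derivative of the p-th
  power of the norm, up to the factor p\<close>

locale smooth_normed_space_over = normed_space_over sc
  for sc :: "'k::{real_normed_field, euclidean_space} \<Rightarrow> 'x::real_normed_vector \<Rightarrow> 'x" +
  assumes norm_differentiable: "x \<noteq> 0 \<Longrightarrow> (norm :: 'x \<Rightarrow> real) differentiable (at x)"
begin

text \<open>At \<open>x = 0\<close>, where \<open>support_map\<close> is junk, the factor \<open>0 powr (p - 1) = 0\<close> makes this vanish
  when \<open>1 < p\<close>.\<close>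

definition duality_map :: "real \<Rightarrow> 'x \<Rightarrow> 'x \<Rightarrow> 'k" where
  "duality_map p x y = norm x powr (p - 1) *\<^sub>R support_map sc x y"

lemma duality_map_0 [simp]: "duality_map p 0 y = 0"
  by (simp add: duality_map_def)

lemma support_map_is_support_map: "x \<noteq> 0 \<Longrightarrow> is_support_map sc x (support_map sc x)"
  by (rule is_support_map_support_map[OF _ norm_differentiable])

lemma duality_map_sc: "duality_map p x (sc c y) = c * duality_map p x y"
  using support_map_is_support_map[of x]
  by (cases "x = 0") (auto simp: duality_map_def is_support_map_def)

lemma norm_duality_map_le:
  assumes "1 < p"
  shows "norm (duality_map p x y) \<le> norm x powr p + norm y powr p"
proof (cases "x = 0")
  case False
  have "norm (duality_map p x y) \<le> norm x powr (p - 1) * norm y"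
    using is_support_map_le_norm[OF support_map_is_support_map[OF False], of y]
    by (simp add: duality_map_def mult_left_mono)
  also have "\<dots> \<le> norm x powr p + norm y powr p"
    using assms by (intro powr_mult_le_add_powr) auto
  finally show ?thesis .
qed simp

text \<open>Two tangents are composed: the real part of the support map at \<open>x\<close> lies
  below the norm, and \<open>t powr p\<close> lies above its tangent at \<open>norm x\<close>, whose
  slope is nonnegative.\<close>

lemma norm_powr_above_tangent:
  assumes "1 < p"
  shows "norm x powr p + p * (duality_map p x y \<bullet> 1) \<le> norm (x + y) powr p"
proof (cases "x = 0")
  case False
  let ?F = "support_map sc x"
  have F: "is_support_map sc x ?F"
    by (rule support_map_is_support_map[OF False])
  have "?F (x + y) = of_real (norm x) + ?F y"
    using F by (simp add: is_support_map_def bounded_linear.linear linear_add)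
  then have "norm x + ?F y \<bullet> 1 = ?F (x + y) \<bullet> 1"
    by (simp add: inner_add_left of_real_def dot_square_norm)
  also have "\<dots> \<le> norm (x + y)"
    using inner_one_le_norm[of "?F (x + y)"] is_support_map_le_norm[OF F, of "x + y"] by simp
  finally have "?F y \<bullet> 1 \<le> norm (x + y) - norm x"
    by simp
  then have "p * norm x powr (p - 1) * (?F y \<bullet> 1) \<le> p * norm x powr (p - 1) * (norm (x + y) - norm x)"
    using assms by (intro mult_left_mono) auto
  then show ?thesis
    using powr_above_tangent[OF assms norm_ge_zero[of x] norm_ge_zero[of "x + y"]]
    by (simp add: duality_map_def mult.assoc)
qed simp

text \<open>Away from 0 this is the chain rule. At 0 the quotient with step \<open>t\<close> equals
  \<open>t powr (p - 1) * norm y powr p\<close>, which tends to 0 because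
  \<open>1 < p\<close>.\<close>

lemma norm_powr_quotient_LIMSEQ:
  assumes "1 < p"
  shows "(\<lambda>n. (norm (x + inverse (Suc n) *\<^sub>R y) powr p - norm x powr p) / inverse (Suc n))
    \<longlonglongrightarrow> p * (duality_map p x y \<bullet> 1)"
proof (cases "x = 0")
  case True
  have "norm (inverse (Suc n) *\<^sub>R y) powr p / inverse (Suc n) = inverse (Suc n) powr (p - 1) * norm y powr p"
    for n
    by (simp add: powr_mult powr_diff)
  moreover have "(\<lambda>n. inverse (real (Suc n)) powr (p - 1) * norm y powr p) \<longlonglongrightarrow> 0 powr (p - 1) * norm y powr p"
    using assms by (intro tendsto_mult tendsto_const tendsto_powr' LIMSEQ_inverse_real_of_nat) auto
  ultimately show ?thesis
    using True assms by simp
next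
  case False
  have "((\<lambda>r. r powr p) has_derivative (\<lambda>r. p * norm x powr (p - 1) * r)) (at (norm x))"
    using has_real_derivative_powr[of "norm x" p] False by (simp add: has_field_derivative_def)
  from has_derivative_compose[OF norm_has_derivative_support_map[OF False norm_differentiable[OF False]] this]
  have "((\<lambda>x. norm x powr p) has_derivative (\<lambda>y. p * (duality_map p x y \<bullet> 1))) (at x)"
    by (simp add: duality_map_def mult.assoc)
  then show ?thesis
    by (rule has_derivative_imp_quotient_LIMSEQ)
qed

end

text \<open>The bound is independent of \<open>t\<close> and serves as the majorant for dominated
  convergence.\<close>

lemma norm_powr_quotient_le:
  fixes x y :: "'x::real_normed_vector"
  assumes "1 < p" "0 < t" "t \<le> 1"
  shows "\<bar>(norm (x + t *\<^sub>R y) powr p - norm x powr p) / t\<bar>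
    \<le> p * 2 powr p * (norm x powr p + norm y powr p)"
proof -
  let ?c = "norm x + norm y"
  have ty: "t * norm y \<le> norm y"
    using assms by (simp add: mult_left_le_one_le)
  have diff: "\<bar>norm (x + t *\<^sub>R y) - norm x\<bar> \<le> t * norm y"
    using norm_triangle_ineq3[of "x + t *\<^sub>R y" x] assms by simp
  have "norm (x + t *\<^sub>R y) \<le> ?c"
    using diff ty by simp
  then have "\<bar>norm (x + t *\<^sub>R y) powr p - norm x powr p\<bar>
      \<le> p * ?c powr (p - 1) * \<bar>norm (x + t *\<^sub>R y) - norm x\<bar>"
    using assms by (intro powr_diff_le) auto
  \<comment> \<open>Enlarging \<open>t * norm y\<close> to \<open>t * ?c\<close> lets the powers of
    \<open>?c\<close> merge into \<open>?c powr p\<close>.\<close>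
  also have "\<dots> \<le> p * ?c powr (p - 1) * (t * ?c)"
    using diff assms by (intro mult_left_mono order_trans[OF diff]) auto
  also have "\<dots> = t * (p * ?c powr p)"
    using assms by (cases "?c = 0") (auto simp: powr_diff add_nonneg_eq_0_iff)
  also have "\<dots> \<le> t * (p * (2 powr p * (norm x powr p + norm y powr p)))"
    using assms by (intro mult_left_mono powr_add_le) auto
  finally show ?thesis
    using assms by (simp add: abs_divide pos_divide_le_eq mult_ac)
qed

context smooth_normed_space_over
begin

text \<open>\<open>support_map\<close> is a definite description, so measurability has to come from
  the difference quotients. These yield only real parts; the other coordinates are real parts in the
  directions \<open>sc c (g s)\<close>.\<close>

lemma borel_measurable_duality_map:
  assumes "1 < p" and h: "strongly_measurable M h" and g: "strongly_measurable M g"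
  shows "(\<lambda>s. duality_map p (h s) (g s)) \<in> borel_measurable M"
proof -
  have "(\<lambda>s. duality_map p (h s) (g s) \<bullet> b) \<in> borel_measurable M" for b
  proof -
    have "linear (\<lambda>z::'k. z \<bullet> b)"
      by (rule bounded_linear.linear[OF bounded_linear_inner_left])
    \<comment> \<open>The coordinate along \<open>b\<close> is the real part after multiplication by
      \<open>c\<close>, and \<open>duality_map_sc\<close> moves \<open>c\<close> into the
      direction.\<close>
    then obtain c :: 'k where c: "\<And>z. z \<bullet> b = (z * c) \<bullet> 1"
      by (rule ex_inner_mult_one) blast
    have "(\<lambda>s. p * (duality_map p (h s) (sc c (g s)) \<bullet> 1)) \<in> borel_measurable M"
    proof (rule borel_measurable_LIMSEQ_real)
      show "(\<lambda>n. (norm (h s + inverse (Suc n) *\<^sub>R sc c (g s)) powr p - norm (h s) powr p) / inverse (Suc n))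
        \<longlonglongrightarrow> p * (duality_map p (h s) (sc c (g s)) \<bullet> 1)" for s
        by (rule norm_powr_quotient_LIMSEQ[OF assms(1)])
      have "strongly_measurable M (\<lambda>s. h s + inverse (Suc n) *\<^sub>R sc c (g s))" for n
        by (rule strongly_measurable_compose2[OF h g])
          (intro continuous_intros bounded_linear.continuous_on[OF bounded_linear_sc_right])
      note [measurable] = borel_measurable_norm_strongly_measurable[OF this]
        borel_measurable_norm_strongly_measurable[OF h]
      show "(\<lambda>s. (norm (h s + inverse (Suc n) *\<^sub>R sc c (g s)) powr p - norm (h s) powr p) / inverse (Suc n))
        \<in> borel_measurable M" for n
        by measurable
    qed
    then have "(\<lambda>s. inverse p * (p * (duality_map p (h s) (sc c (g s)) \<bullet> 1))) \<in> borel_measurable M"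
      by measurable
    then show ?thesis
      using assms(1) by (simp add: c duality_map_sc mult.commute[of c] flip: mult.assoc)
  qed
  then show ?thesis
    by (subst borel_measurable_euclidean_space) auto
qed

section \<open>Integrated tangents and the characterization of best approximants\<close>

lemma integrable_duality_map:
  assumes "1 < p" "h \<in> Lp_space M p" "g \<in> Lp_space M p"
  shows "integrable M (\<lambda>s. duality_map p (h s) (g s))"
proof (rule Bochner_Integration.integrable_bound)
  show "integrable M (\<lambda>s. norm (h s) powr p + norm (g s) powr p)"
    using assms by (simp add: Lp_space_def)
  show "(\<lambda>s. duality_map p (h s) (g s)) \<in> borel_measurable M"
    using assms by (intro borel_measurable_duality_map) (auto simp: Lp_space_def)
  show "AE s in M. norm (duality_map p (h s) (g s)) \<le> norm (norm (h s) powr p + norm (g s) powr p)"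
    using norm_duality_map_le[OF assms(1)] by simp
qed

text \<open>This gives sufficiency: where the integral of the duality map vanishes, the perturbed
  integral is no smaller.\<close>

lemma Lp_power_above_tangent:
  assumes "1 < p" "h \<in> Lp_space M p" "g \<in> Lp_space M p"
  shows "(LINT s|M. norm (h s) powr p) + p * ((LINT s|M. duality_map p (h s) (g s)) \<bullet> 1)
    \<le> (LINT s|M. norm (h s + g s) powr p)"
proof -
  note int = integrable_duality_map[OF assms]
  have h: "integrable M (\<lambda>s. norm (h s) powr p)"
    using assms(2) by (simp add: Lp_space_def)
  have "(LINT s|M. norm (h s) powr p) + p * ((LINT s|M. duality_map p (h s) (g s)) \<bullet> 1)
      = (LINT s|M. norm (h s) powr p + p * (duality_map p (h s) (g s) \<bullet> 1))"
    using int h by simp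
  also have "\<dots> \<le> (LINT s|M. norm (h s + g s) powr p)"
    using int h Lp_space_add[of p h M g] assms
    by (intro integral_mono norm_powr_above_tangent) (auto simp: Lp_space_def plus_fun_def)
  finally show ?thesis .
qed

text \<open>This gives necessity: at a minimum all these quotients are nonnegative, and so is their
  limit.\<close>

lemma Lp_power_quotient_LIMSEQ:
  assumes "1 < p" "h \<in> Lp_space M p" "g \<in> Lp_space M p"
  shows "(\<lambda>n. LINT s|M. (norm (h s + inverse (Suc n) *\<^sub>R g s) powr p - norm (h s) powr p) / inverse (Suc n))
    \<longlonglongrightarrow> p * ((LINT s|M. duality_map p (h s) (g s)) \<bullet> 1)"
proof -
  note int = integrable_duality_map[OF assms]
  have h: "strongly_measurable M h" and g: "strongly_measurable M g"
    using assms by (auto simp: Lp_space_def)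
  have "(\<lambda>n. LINT s|M. (norm (h s + inverse (Suc n) *\<^sub>R g s) powr p - norm (h s) powr p) / inverse (Suc n))
    \<longlonglongrightarrow> (LINT s|M. p * (duality_map p (h s) (g s) \<bullet> 1))"
  proof (rule integral_dominated_convergence)
    show "(\<lambda>s. p * (duality_map p (h s) (g s) \<bullet> 1)) \<in> borel_measurable M"
      using int by auto
    have "strongly_measurable M (\<lambda>s. h s + inverse (Suc n) *\<^sub>R g s)" for n
      by (rule strongly_measurable_compose2[OF h g]) (intro continuous_intros)
    note [measurable] = borel_measurable_norm_strongly_measurable[OF this]
      borel_measurable_norm_strongly_measurable[OF h]
    show "(\<lambda>s. (norm (h s + inverse (Suc n) *\<^sub>R g s) powr p - norm (h s) powr p) / inverse (Suc n))
      \<in> borel_measurable M" for n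
      by measurable
    show "integrable M (\<lambda>s. p * 2 powr p * (norm (h s) powr p + norm (g s) powr p))"
      using assms by (simp add: Lp_space_def)
    show "AE s in M. (\<lambda>n. (norm (h s + inverse (Suc n) *\<^sub>R g s) powr p - norm (h s) powr p) / inverse (Suc n))
      \<longlonglongrightarrow> p * (duality_map p (h s) (g s) \<bullet> 1)"
      by (intro AE_I2 norm_powr_quotient_LIMSEQ[OF assms(1)])
    show "AE s in M. norm ((norm (h s + inverse (Suc n) *\<^sub>R g s) powr p - norm (h s) powr p) / inverse (Suc n))
      \<le> p * 2 powr p * (norm (h s) powr p + norm (g s) powr p)" for n
      unfolding real_norm_def
      by (intro AE_I2 norm_powr_quotient_le[OF assms(1)]) (auto simp: field_simps)
  qed
  then show ?thesis
    using int by simp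
qed

lemma Lp_subspace_iff:
  "Lp_subspace sc M p G \<longleftrightarrow> G \<subseteq> Lp_space M p \<and> 0 \<in> G \<and> (\<forall>g\<in>G. \<forall>h\<in>G. g + h \<in> G) \<and>
    (\<forall>c. \<forall>g\<in>G. (\<lambda>s. sc c (g s)) \<in> G)"
proof -
  interpret fm: module "\<lambda>c g s. sc c (g s)"
    by unfold_locales (auto simp: fun_eq_iff scale_left_distrib scale_right_distrib)
  show ?thesis
    unfolding Lp_subspace_def fm.subspace_def by blast
qed

lemma best_approximants_Lp_iff:
  assumes p: "1 < p" and G: "Lp_subspace sc M p G" and f: "f \<in> Lp_space M p" and g0: "g0 \<in> G"
  shows "g0 \<in> best_approximants (Lp_norm M p) G f \<longleftrightarrow>
    (\<forall>g\<in>G. (LINT s|M. duality_map p (f s - g0 s) (g s)) = 0)"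
proof -
  define h where "h = f - g0"
  have GLp: "G \<subseteq> Lp_space M p" and add: "\<And>g g'. g \<in> G \<Longrightarrow> g' \<in> G \<Longrightarrow> g + g' \<in> G"
    and sc: "\<And>c g. g \<in> G \<Longrightarrow> (\<lambda>s. sc c (g s)) \<in> G"
    using G by (auto simp: Lp_subspace_iff)
  have uminus: "- g \<in> G" if "g \<in> G" for g
    using sc[OF that, of "-1"] by (simp add: fun_Compl_def)
  have h: "h \<in> Lp_space M p"
    using Lp_space_add[OF _ f Lp_space_uminus, of g0] GLp g0 p by (auto simp: h_def)
  let ?\<Phi> = "\<lambda>g. LINT s|M. norm (h s + g s) powr p"
  let ?J = "\<lambda>g. LINT s|M. duality_map p (h s) (g s)"
  have "g0 \<in> best_approximants (Lp_norm M p) G f \<longleftrightarrow> (\<forall>g\<in>G. Lp_norm M p h \<le> Lp_norm M p (f - g))"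
    unfolding h_def using g0 by (intro best_approximants_iff) (simp add: Lp_norm_def)
  \<comment> \<open>The substitution of \<open>g0 - g\<close> for \<open>g\<close> maps the subspace
    \<open>G\<close> onto itself and moves the minimum to the direction 0.\<close>
  also have "\<dots> \<longleftrightarrow> (\<forall>g\<in>G. Lp_norm M p h \<le> Lp_norm M p (h + g))"
  proof (intro iffI ballI)
    fix g assume *: "\<forall>g\<in>G. Lp_norm M p h \<le> Lp_norm M p (f - g)" "g \<in> G"
    then have "g0 - g \<in> G"
      using add[OF g0 uminus, of g] by simp
    moreover have "f - (g0 - g) = h + g"
      by (simp add: h_def)
    ultimately show "Lp_norm M p h \<le> Lp_norm M p (h + g)"
      using * by metis
  next
    fix g assume *: "\<forall>g\<in>G. Lp_norm M p h \<le> Lp_norm M p (h + g)" "g \<in> G"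
    then have "g0 - g \<in> G"
      using add[OF g0 uminus, of g] by simp
    moreover have "f - g = h + (g0 - g)"
      by (simp add: h_def)
    ultimately show "Lp_norm M p h \<le> Lp_norm M p (f - g)"
      using * by metis
  qed
  also have "\<dots> \<longleftrightarrow> (\<forall>g\<in>G. (LINT s|M. norm (h s) powr p) \<le> ?\<Phi> g)"
    using p by (simp add: Lp_norm_le_iff)
  also have "\<dots> \<longleftrightarrow> (\<forall>g\<in>G. ?J g = 0)"
  proof (intro iffI ballI)
    fix g assume "\<forall>g\<in>G. ?J g = 0" "g \<in> G"
    then show "(LINT s|M. norm (h s) powr p) \<le> ?\<Phi> g"
      using Lp_power_above_tangent[OF p h, of g] GLp by auto
  next
    fix g assume min: "\<forall>g\<in>G. (LINT s|M. norm (h s) powr p) \<le> ?\<Phi> g" and g: "g \<in> G"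
    have nonneg: "0 \<le> ?J g \<bullet> 1" if g: "g \<in> G" for g
    proof -
      have "0 \<le> (LINT s|M. (norm (h s + inverse (Suc n) *\<^sub>R g s) powr p - norm (h s) powr p) / inverse (Suc n))"
        for n
      proof -
        have tg: "(\<lambda>s. inverse (Suc n) *\<^sub>R g s) \<in> G"
          using sc[OF g, of "of_real (inverse (Suc n))"] by (simp add: sc_of_real del: of_real_inverse)
        then have "integrable M (\<lambda>s. norm (h s + inverse (Suc n) *\<^sub>R g s) powr p)"
          using Lp_space_add[OF _ h, of "\<lambda>s. inverse (Suc n) *\<^sub>R g s"] GLp p
          by (auto simp: Lp_space_def plus_fun_def)
        moreover have "integrable M (\<lambda>s. norm (h s) powr p)"
          using h by (simp add: Lp_space_def)
        ultimately show ?thesis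
          using bspec[OF min tg] by simp
      qed
      moreover have "g \<in> Lp_space M p"
        using GLp g by auto
      ultimately have "0 \<le> p * (?J g \<bullet> 1)"
        by (intro LIMSEQ_le_const[OF Lp_power_quotient_LIMSEQ[OF p h, of g]]) blast+
      then show ?thesis
        using p by (simp add: zero_le_mult_iff)
    qed
    show "?J g = 0"
    proof (rule ccontr)
      assume "?J g \<noteq> 0"
      \<comment> \<open>This scalar makes the integral in the direction \<open>sc c (g s)\<close>
        equal to -1, so one choice handles the sign and the phase together and contradicts
        \<open>nonneg\<close>.\<close>
      define c where "c = - inverse (?J g)"
      have "?J (\<lambda>s. sc c (g s)) = c * ?J g"
        by (simp add: duality_map_sc)
      also have "\<dots> = - 1"
        using \<open>?J g \<noteq> 0\<close> by (simp add: c_def)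
      finally show False
        using nonneg[OF sc[OF g, of c]] by (simp add: dot_square_norm)
    qed
  qed
  finally show ?thesis
    by (simp add: h_def)
qed

end

theorem theorem3p6:
  fixes M :: "'s measure"
    and p :: real
    and sc :: "'k::{real_normed_field, euclidean_space} \<Rightarrow> 'x::banach \<Rightarrow> 'x"
    and G :: "('s \<Rightarrow> 'x) set"
    and f g0 :: "'s \<Rightarrow> 'x"
  assumes "normed_space_over sc"
    and "1 < p"
    and "\<And>x::'x. x \<noteq> 0 \<Longrightarrow> (norm :: 'x \<Rightarrow> real) differentiable (at x)"
    and "Lp_subspace sc M p G"
    and "f \<in> Lp_space M p - Lp_closure M p G"
    and "g0 \<in> G"
  shows "(\<forall>g\<in>G. set_integrable M (space M - zero_set M (f - g0))
            (\<lambda>s. norm (f s - g0 s) powr (p - 1) *\<^sub>R support_map sc (f s - g0 s) (g s))) \<and>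
    (g0 \<in> best_approximants (Lp_norm M p) G f \<longleftrightarrow>
      (\<forall>g\<in>G. (LINT s:(space M - zero_set M (f - g0))|M.
         norm (f s - g0 s) powr (p - 1) *\<^sub>R support_map sc (f s - g0 s) (g s)) = 0))"
proof -
  interpret normed_space_over sc by fact
  interpret smooth_normed_space_over sc
    by unfold_locales (rule assms(3))
  have f: "f \<in> Lp_space M p" and GLp: "G \<subseteq> Lp_space M p"
    using assms(4,5) by (auto simp: Lp_subspace_def)
  have h: "f - g0 \<in> Lp_space M p"
    using Lp_space_add[OF _ f Lp_space_uminus, of g0] GLp assms(2,6) by auto
  \<comment> \<open>On the zero set the indicator removes the undetermined support map, and
    \<open>duality_map\<close> vanishes there as well.\<close>
  have ind: "indicator (space M - zero_set M (f - g0)) s *\<^sub>R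
        (norm (f s - g0 s) powr (p - 1) *\<^sub>R support_map sc (f s - g0 s) (g s))
      = duality_map p (f s - g0 s) (g s)" if "s \<in> space M" for s g
    using that by (auto simp: duality_map_def zero_set_def indicator_def)
  \<comment> \<open>Integrability ensures that a vanishing integral is not merely the default value
    of the Bochner integral.\<close>
  have "set_integrable M (space M - zero_set M (f - g0))
      (\<lambda>s. norm (f s - g0 s) powr (p - 1) *\<^sub>R support_map sc (f s - g0 s) (g s))" if "g \<in> G" for g
    using integrable_duality_map[OF assms(2) h, of g] that GLp
    unfolding set_integrable_def
    by (subst Bochner_Integration.integrable_cong[OF refl ind]) auto
  moreover have "(LINT s:(space M - zero_set M (f - g0))|M.
        norm (f s - g0 s) powr (p - 1) *\<^sub>R support_map sc (f s - g0 s) (g s))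
      = (LINT s|M. duality_map p (f s - g0 s) (g s))" for g
    unfolding set_lebesgue_integral_def by (intro Bochner_Integration.integral_cong ind refl)
  ultimately show ?thesis
    using best_approximants_Lp_iff[OF assms(2,4) f assms(6)] by simp
qed

end
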